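(* Let $A=\{a_1,\dots,a_k\}$ be a set of $k\ge 4$ integers, and let $2h_1$ and $2h_2$ be the first and second $L^1$-minima of the coefficient lattice $\mathcal{L}$ of $A$. If $1\le h<h_1$, then \[|hA|=\binom{h+k-1}{k-1}.\] If $h_1\le h<h_2$, then \[|hA|=\binom{h+k-1}{k-1}-\binom{h-h_1+k-1}{k-1}.\]
   Context: For a finite set $A\subseteq\mathbb{Z}$ and a positive integer $h$, the $h$-fold sumset is $hA=\{x_1+\dots+x_h : x_i\in A\}$. Write $\vec a=\langle a_1,\dots,a_k\rangle$ and $\vec 1=\langle1,\dots,1\rangle\in\mathbb{Z}^k$. The coefficient lattice of $A$ is $\mathcal{L}=\{\vec c\in\mathbb{Z}^k:\vec c\cdot\vec 1=0,\ \vec c\cdot\vec a=0\}$ (of dimension $k-2$). For $i\ge1$, the $i$-th successive $L^1$-minimum of $\mathcal{L}$ is the infimum of those $\lambda$ such that $\{\vec c\in\mathcal{L}:\|\vec c\|_1\le\lambda\}$ contains $i$ linearly independent vectors; for this lattice these minima are even integers, denoted here $2h_1$ (first) and $2h_2$ (second). Binomial coefficients $\binom{n}{m}$ are taken to be $0$ when $n<m$. *)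

theory Defs
  imports "HOL-Analysis.Analysis"
begin

definition sumset :: "nat \<Rightarrow> int set \<Rightarrow> int set" where
  "sumset h A = {\<Sum>i<h. x i | x. \<forall>i<h. x i \<in> A}"

definition l1_norm :: "real ^ 'n \<Rightarrow> real" where
  "l1_norm c = (\<Sum>i\<in>UNIV. \<bar>c $ i\<bar>)"

(* Integer vectors are embedded in real ^ 'n so that the inner product and linear
   independence of HOL-Analysis apply directly. *)
definition coefficient_lattice :: "int ^ 'n \<Rightarrow> (real ^ 'n) set" where
  "coefficient_lattice a =
     {c. (\<forall>i. c $ i \<in> \<int>) \<and> c \<bullet> (\<chi> i. 1) = 0 \<and> c \<bullet> (\<chi> i. of_int (a $ i)) = 0}"

(* For i = 0 this is the infimum of all reals, and if L contains no i linearly independent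
   vectors it is Inf {}; both values are meaningless. *)
definition successive_l1_minimum :: "nat \<Rightarrow> (real ^ 'n) set \<Rightarrow> real" where
  "successive_l1_minimum i L =
     Inf {r. \<exists>B \<subseteq> {c \<in> L. l1_norm c \<le> r}. finite B \<and> card B = i \<and> independent B}"

lemma l1_norm_coefficient_lattice:
  assumes "c \<in> coefficient_lattice a"
  shows "\<exists>m::nat. l1_norm c = real (2 * m)"
proof -
  have Z: "\<And>i. c $ i \<in> \<int>" and s: "(\<Sum>i\<in>UNIV. c $ i) = 0"
    using assms by (auto simp: coefficient_lattice_def inner_vec_def)
  define d where "d i = \<lfloor>c $ i\<rfloor>" for i
  have d: "c $ i = of_int (d i)" for i
    using Z[of i] by (auto simp: d_def elim: Ints_cases)
  have "real_of_int (\<Sum>i\<in>UNIV. d i) = 0" using s by (simp add: d)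
  then have s0: "(\<Sum>i\<in>UNIV. d i) = 0" by linarith
  have "even (\<Sum>i\<in>UNIV. \<bar>d i\<bar> - d i)" by (rule dvd_sum) auto
  then have "even (\<Sum>i\<in>UNIV. \<bar>d i\<bar>)" by (simp add: sum_subtractf s0)
  then obtain m where m: "(\<Sum>i\<in>UNIV. \<bar>d i\<bar>) = 2 * m" by (elim evenE)
  have "0 \<le> (\<Sum>i\<in>UNIV. \<bar>d i\<bar>)" by (rule sum_nonneg) simp
  with m have "m \<ge> 0" by simp
  have "l1_norm c = of_int (\<Sum>i\<in>UNIV. \<bar>d i\<bar>)" by (simp add: l1_norm_def d)
  then have "l1_norm c = real (2 * nat m)" using m \<open>m \<ge> 0\<close> by simp
  then show ?thesis by blast
qed

lemma coefficient_lattice_two_independent: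
  fixes a :: "int ^ 'n"
  assumes inj: "inj (\<lambda>j. a $ j)" and card: "CARD('n) \<ge> 4"
  shows "\<exists>B \<subseteq> coefficient_lattice a. finite B \<and> card B = 2 \<and> independent B"
proof -
  obtain T where "T \<subseteq> (UNIV :: 'n set)" "card T = 4"
    using obtain_subset_with_card_n[OF card] by metis
  then obtain p q r s :: 'n where
    dist: "p \<noteq> q" "p \<noteq> r" "p \<noteq> s" "q \<noteq> r" "q \<noteq> s" "r \<noteq> s"
    by (auto simp: card_Suc_eq numeral_eq_Suc)
  define v where "v t = ((\<chi> j. of_int (if j = p then a $ t - a $ q
      else if j = q then a $ p - a $ t
      else if j = t then a $ q - a $ p else 0)) :: real ^ 'n)" for t
  have v: "v t \<in> coefficient_lattice a" if "t \<noteq> p" "t \<noteq> q" for t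
  proof -
    have *: "(\<Sum>j\<in>UNIV. v t $ j * g j) = (\<Sum>j\<in>{p, q, t}. v t $ j * g j)" for g
      by (rule sum.mono_neutral_right) (auto simp: v_def)
    show ?thesis
      using that dist(1) *[of "\<lambda>_. 1"] *[of "\<lambda>j. of_int (a $ j)"]
      by (auto simp: coefficient_lattice_def inner_vec_def v_def algebra_simps)
  qed
  have apq: "a $ q \<noteq> a $ p" using inj dist(1) by (auto dest: injD)
  have vr: "v r $ r \<noteq> 0" "v s $ r = 0" "v s $ s \<noteq> 0" "v r $ s = 0"
    using dist apq by (auto simp: v_def)
  then have ne: "v r \<noteq> v s" by metis
  have "v r \<noteq> k *\<^sub>R v s" for k
  proof
    assume "v r = k *\<^sub>R v s"
    then have "v r $ r = k * v s $ r" by simp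
    with vr show False by simp
  qed
  then have "v r \<notin> span {v s}" by (auto simp: span_singleton)
  moreover have "v s \<noteq> 0" using vr(3) by auto
  ultimately have "independent {v r, v s}"
    using ne by (simp add: independent_insert)
  then show ?thesis using ne v[of r] v[of s] dist
    by (intro exI[of _ "{v r, v s}"]) auto
qed

lemma successive_l1_minimum_even:
  fixes a :: "int ^ 'n"
  assumes inj: "inj (\<lambda>j. a $ j)" and card: "CARD('n) \<ge> 4" and i: "i = 1 \<or> i = 2"
  shows "\<exists>m::nat. successive_l1_minimum i (coefficient_lattice a) = real (2 * m)"
proof -
  let ?L = "coefficient_lattice a"
  define S where "S = {r. \<exists>B \<subseteq> {c \<in> ?L. l1_norm c \<le> r}. finite B \<and> card B = i \<and> independent B}"
  obtain B2 where "B2 \<subseteq> ?L" "finite B2" "card B2 = 2" "independent B2"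
    using coefficient_lattice_two_independent[OF inj card] by blast
  then obtain B0 where B0: "B0 \<subseteq> ?L" "finite B0" "card B0 = i" "independent B0"
    using i by (metis obtain_subset_with_card_n independent_mono subset_trans
        one_le_numeral)
  have key: "\<exists>m::nat. real (2 * m) \<in> S \<and> real (2 * m) = Max (l1_norm ` B)"
    if B: "B \<subseteq> ?L" "finite B" "card B = i" "independent B" for B
  proof -
    have "B \<noteq> {}" using B i by auto
    then have "Max (l1_norm ` B) \<in> l1_norm ` B" using B by simp
    then obtain c where "c \<in> B" and c: "Max (l1_norm ` B) = l1_norm c" by auto
    then obtain m :: nat where m: "Max (l1_norm ` B) = real (2 * m)"
      using l1_norm_coefficient_lattice[of c a] B(1) by auto
    have "l1_norm b \<le> real (2 * m)" if "b \<in> B" for b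
      unfolding m[symmetric] using that B(2) by (intro Max_ge) auto
    then have "B \<subseteq> {c \<in> ?L. l1_norm c \<le> real (2 * m)}" using B(1) by auto
    then have "real (2 * m) \<in> S" unfolding S_def using B(2-4) by blast
    with m show ?thesis by metis
  qed
  define m where "m = (LEAST m::nat. real (2 * m) \<in> S)"
  obtain n0 :: nat where n0: "real (2 * n0) \<in> S" using key[OF B0] by auto
  have mS: "real (2 * m) \<in> S" unfolding m_def
    by (rule LeastI[where P = "\<lambda>m. real (2 * m) \<in> S"]) (rule n0)
  have "real (2 * m) \<le> r" if rS: "r \<in> S" for r
  proof -
    obtain B where B: "B \<subseteq> {c \<in> ?L. l1_norm c \<le> r}" "finite B" "card B = i" "independent B"
      using rS unfolding S_def by blast
    obtain n :: nat where n: "real (2 * n) \<in> S" "real (2 * n) = Max (l1_norm ` B)"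
      using key[of B] B by (metis (no_types, lifting) mem_Collect_eq subset_iff)
    have "B \<noteq> {}" using B i by auto
    then have "Max (l1_norm ` B) \<le> r" using B by (subst Max_le_iff) auto
    moreover have "m \<le> n" unfolding m_def using n(1) by (rule Least_le)
    ultimately show ?thesis using n(2) by linarith
  qed
  then have "Inf S = real (2 * m)" using mS by (intro cInf_eq_minimum) auto
  then show ?thesis unfolding successive_l1_minimum_def S_def by (rule exI)
qed

end

theory Submission
  imports Defs
begin

text \<open>An element of \<open>hA\<close> is the value \<open>x \<bullet> a\<close> of a vector \<open>x\<close> of natural numbers
  with coordinate sum \<open>h\<close>, and two such vectors have the same value iff their difference lies in
  the coefficient lattice, where it has \<open>L\<^sup>1\<close>-norm at most \<open>2h\<close>. If \<open>h < h\<^sub>1\<close> this forces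
  equality. If \<open>h\<^sub>1 \<le> h < h\<^sub>2\<close> the difference is an integer multiple of a shortest lattice
  vector \<open>d\<close>, so every value has exactly one representation \<open>x\<close> for which \<open>x - d\<close> has a negative
  coordinate. The vectors to be discarded are those above the positive part of \<open>d\<close>, and since
  that part has coordinate sum \<open>h\<^sub>1\<close>, they correspond to the vectors with coordinate sum
  \<open>h - h\<^sub>1\<close>.\<close>

section \<open>Vectors of natural numbers with prescribed coordinate sum\<close>

definition compositions :: "nat \<Rightarrow> ('n::finite \<Rightarrow> nat) set" where
  "compositions h = {x. sum x UNIV = h}"

definition weight :: "int ^ 'n \<Rightarrow> ('n::finite \<Rightarrow> nat) \<Rightarrow> int" where
  "weight a x = (\<Sum>j\<in>UNIV. int (x j) * a $ j)"

text \<open>Bridge between integer-valued functions, on which the counting is done, and the real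
  vectors among which the lattice and its norm live.\<close>

definition of_int_vec :: "('n::finite \<Rightarrow> int) \<Rightarrow> real ^ 'n" where
  "of_int_vec d = (\<chi> i. of_int (d i))"

text \<open>Fixing an enumeration \<open>js\<close> of the index type identifies these functions
  with lists of length \<open>CARD('n)\<close> and sum \<open>h\<close>, for which
  \<open>card_length_sum_list\<close> is stars and bars.\<close>

lemma card_compositions:
  "card (compositions h :: ('n::finite \<Rightarrow> nat) set) = (h + CARD('n) - 1) choose (CARD('n) - 1)"
proof -
  obtain js :: "'n list" where js: "set js = UNIV" "distinct js"
    using finite_distinct_list[OF finite] by blast
  then have len: "length js = CARD('n)" by (metis distinct_card)
  have "bij_betw (\<lambda>x. map x js) (compositions h) {l. length l = CARD('n) \<and> sum_list l = h}"
    unfolding bij_betw_def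
  proof
    show "inj_on (\<lambda>x. map x js) (compositions h :: ('n \<Rightarrow> nat) set)"
      using js(1) by (auto simp: inj_on_def)
    show "(\<lambda>x. map x js) ` compositions h = {l. length l = CARD('n) \<and> sum_list l = h}"
    proof (intro equalityI subsetI)
      fix l assume "l \<in> (\<lambda>x. map x js) ` compositions h"
      then show "l \<in> {l. length l = CARD('n) \<and> sum_list l = h}"
        using js len by (auto simp: compositions_def sum_list_distinct_conv_sum_set)
    next
      fix l assume l: "l \<in> {l. length l = CARD('n) \<and> sum_list l = h}"
      \<comment> \<open>Inverse of \<open>map\<close>: the entry of \<open>l\<close> at the position
        that \<open>j\<close> has in \<open>js\<close>.\<close>
      define x where "x j = the (map_of (zip js l) j)" for j
      have "map x js = l"
        using l js len by (intro nth_equalityI) (auto simp: x_def map_of_zip_nth)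
      moreover have "sum x UNIV = sum_list (map x js)"
        using js by (simp add: sum_list_distinct_conv_sum_set)
      ultimately show "l \<in> (\<lambda>x. map x js) ` compositions h"
        using l by (auto simp: compositions_def)
    qed
  qed
  then have "card (compositions h :: ('n \<Rightarrow> nat) set) = (h + CARD('n) - 1) choose h"
    by (simp add: bij_betw_same_card card_length_sum_list)
  also have "\<dots> = (h + CARD('n) - 1) choose (CARD('n) - 1)"
    using zero_less_card_finite[where 'a='n]
    by (subst binomial_symmetric) auto
  finally show ?thesis .
qed

lemma finite_compositions: "finite (compositions h :: ('n::finite \<Rightarrow> nat) set)"
proof -
  have "compositions h \<subseteq> (UNIV :: 'n set) \<rightarrow>\<^sub>E {..h}"
    by (auto simp: compositions_def PiE_def Pi_def intro: member_le_sum)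
  then show ?thesis by (rule finite_subset) (simp add: finite_PiE)
qed

section \<open>Sumset elements as values of multiplicity vectors\<close>

lemma sumset_Suc: "sumset (Suc h) A = {s + t | s t. s \<in> sumset h A \<and> t \<in> A}"
proof (intro equalityI subsetI)
  fix z assume "z \<in> sumset (Suc h) A"
  then show "z \<in> {s + t | s t. s \<in> sumset h A \<and> t \<in> A}"
    unfolding sumset_def by fastforce
next
  fix z assume "z \<in> {s + t | s t. s \<in> sumset h A \<and> t \<in> A}"
  then obtain x t where x: "\<forall>i<h. x i \<in> A" "t \<in> A" "z = (\<Sum>i<h. x i) + t"
    unfolding sumset_def by blast
  then show "z \<in> sumset (Suc h) A"
    unfolding sumset_def by (intro CollectI exI[of _ "x(h := t)"]) (auto simp: less_Suc_eq)
qed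

text \<open>The coordinate \<open>x j\<close> counts how often \<open>a $ j\<close> occurs as a
  summand. Induction on \<open>h\<close>: adding a summand \<open>a $ j\<close> raises the
  \<open>j\<close>-th multiplicity by one, and conversely a vector of sum \<open>Suc h\<close> has a
  positive coordinate that can be lowered.\<close>

lemma sumset_eq_weight:
  fixes a :: "int ^ 'n"
  shows "sumset h (range (\<lambda>i. a $ i)) = weight a ` compositions h"
proof (induction h)
  case 0
  show ?case
    by (auto simp: sumset_def weight_def compositions_def image_def intro!: exI[of _ "\<lambda>_. 0"])
next
  case (Suc h)
  have upd: "sum (x(j := Suc (x j))) UNIV = Suc (sum x UNIV)"
    "weight a (x(j := Suc (x j))) = weight a x + a $ j" for x and j :: 'n
  proof -
    show "sum (x(j := Suc (x j))) UNIV = Suc (sum x UNIV)"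
      by (subst (1 2) sum.remove[of _ j]) (auto intro: sum.cong)
    have "(\<Sum>i\<in>UNIV - {j}. int ((x(j := Suc (x j))) i) * a $ i)
        = (\<Sum>i\<in>UNIV - {j}. int (x i) * a $ i)"
      by (rule sum.cong) auto
    then show "weight a (x(j := Suc (x j))) = weight a x + a $ j"
      unfolding weight_def by (subst (1 2) sum.remove[of _ j]) (auto simp: algebra_simps)
  qed
  show ?case
  proof (intro equalityI subsetI)
    fix z assume "z \<in> sumset (Suc h) (range (\<lambda>i. a $ i))"
    then obtain x j where "x \<in> compositions h" "z = weight a x + a $ j"
      by (auto simp: sumset_Suc Suc.IH)
    then show "z \<in> weight a ` compositions (Suc h)"
      by (intro image_eqI[of _ _ "x(j := Suc (x j))"])
        (simp_all add: upd compositions_def del: fun_upd_apply)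
  next
    fix z assume "z \<in> weight a ` compositions (Suc h)"
    then obtain y where y: "sum y UNIV = Suc h" "z = weight a y"
      by (auto simp: compositions_def)
    then obtain j where "y j > 0"
      by (metis gr0I sum.neutral Zero_not_Suc)
    then obtain m where m: "y j = Suc m" by (cases "y j") auto
    define x where "x = y(j := m)"
    have yx: "y = x(j := Suc (x j))" using m by (auto simp: x_def)
    have "x \<in> compositions h" "z = weight a x + a $ j"
      using upd[of x j] y unfolding yx[symmetric] by (auto simp: compositions_def)
    then show "z \<in> sumset (Suc h) (range (\<lambda>i. a $ i))"
      by (auto simp: sumset_Suc Suc.IH)
  qed
qed

section \<open>Integer lattice vectors and the successive minima\<close>

lemma of_int_vec_in_coefficient_lattice_iff:
  "of_int_vec d \<in> coefficient_lattice a \<longleftrightarrow>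
     (\<Sum>i\<in>UNIV. d i) = 0 \<and> (\<Sum>i\<in>UNIV. d i * a $ i) = 0"
proof -
  have "(\<Sum>i\<in>UNIV. real_of_int (d i) * of_int (a $ i)) = of_int (\<Sum>i\<in>UNIV. d i * a $ i)"
    "(\<Sum>i\<in>UNIV. real_of_int (d i)) = of_int (\<Sum>i\<in>UNIV. d i)"
    by simp_all
  then show ?thesis
    unfolding coefficient_lattice_def of_int_vec_def inner_vec_def
    by (simp del: of_int_sum of_int_mult)
qed

lemma coefficient_lattice_of_int_vecE:
  assumes "c \<in> coefficient_lattice a"
  obtains d where "c = of_int_vec d"
proof
  show "c = of_int_vec (\<lambda>i. \<lfloor>c $ i\<rfloor>)"
    using assms by (auto simp: coefficient_lattice_def of_int_vec_def vec_eq_iff)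
qed

lemma coefficient_lattice_diff_scaleR:
  assumes "c \<in> coefficient_lattice a" "v \<in> coefficient_lattice a"
  shows "v - of_int m *\<^sub>R c \<in> coefficient_lattice a"
  using assms by (auto simp: coefficient_lattice_def inner_diff_left)

lemma l1_norm_of_int_vec: "l1_norm (of_int_vec d) = of_int (\<Sum>i\<in>UNIV. \<bar>d i\<bar>)"
  by (simp add: l1_norm_def of_int_vec_def)

lemma l1_norm_nonneg: "l1_norm c \<ge> 0"
  by (simp add: l1_norm_def sum_nonneg)

lemma l1_norm_scaleR: "l1_norm (r *\<^sub>R c) = \<bar>r\<bar> * l1_norm c"
  by (simp add: l1_norm_def abs_mult sum_distrib_left)

text \<open>Since \<open>i > 0\<close>, every admissible radius bounds the norm of some vector, so
  the set under the infimum is bounded below by \<open>0\<close>.\<close>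

lemma successive_l1_minimum_le:
  assumes "B \<subseteq> L" "finite B" "card B = i" "independent B" "i > 0"
    and "\<And>b. b \<in> B \<Longrightarrow> l1_norm b \<le> r"
  shows "successive_l1_minimum i L \<le> r"
  unfolding successive_l1_minimum_def
proof (rule cInf_lower)
  show "r \<in> {r. \<exists>B\<subseteq>{c \<in> L. l1_norm c \<le> r}. finite B \<and> card B = i \<and> independent B}"
    using assms by blast
  show "bdd_below {r. \<exists>B\<subseteq>{c \<in> L. l1_norm c \<le> r}. finite B \<and> card B = i \<and> independent B}"
  proof (rule bdd_belowI[of _ 0])
    fix s assume "s \<in> {r. \<exists>B\<subseteq>{c \<in> L. l1_norm c \<le> r}. finite B \<and> card B = i \<and> independent B}"
    then obtain B where "B \<subseteq> {c \<in> L. l1_norm c \<le> s}" "card B = i" by blast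
    moreover from this \<open>i > 0\<close> obtain b where "b \<in> B"
      by (metis card.empty ex_in_conv less_irrefl)
    ultimately have "l1_norm b \<le> s" by blast
    then show "0 \<le> s" using l1_norm_nonneg[of b] by linarith
  qed
qed

lemma first_l1_minimum_le:
  assumes "c \<in> L" "c \<noteq> 0"
  shows "successive_l1_minimum 1 L \<le> l1_norm c"
  using assms by (intro successive_l1_minimum_le[of "{c}"]) auto

text \<open>The infimum provides a nonzero lattice vector of norm below \<open>2 * h1 + 1\<close>.
  Lattice norms are even and this one is at least \<open>2 * h1\<close>, so it equals
  \<open>2 * h1\<close>.\<close>

lemma first_l1_minimum_attained:
  fixes a :: "int ^ 'n"
  assumes "inj (\<lambda>i. a $ i)" "CARD('n) \<ge> 4"
    and h1: "successive_l1_minimum 1 (coefficient_lattice a) = real (2 * h1)"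
  obtains c where "c \<in> coefficient_lattice a" "c \<noteq> 0" "l1_norm c = real (2 * h1)"
proof -
  let ?L = "coefficient_lattice a"
  let ?S = "{r. \<exists>B\<subseteq>{c \<in> ?L. l1_norm c \<le> r}. finite B \<and> card B = 1 \<and> independent B}"
  \<comment> \<open>The pair only supplies a nonzero lattice vector, so that the infimum is taken
    over a nonempty set.\<close>
  obtain B where "B \<subseteq> ?L" "card B = 2" "independent B"
    using coefficient_lattice_two_independent[OF assms(1,2)] by blast
  then obtain b where "b \<in> ?L" "b \<noteq> 0"
    by (metis card.empty dependent_zero ex_in_conv subset_iff zero_neq_numeral)
  then have "l1_norm b \<in> ?S"
    by (intro CollectI exI[of _ "{b}"]) auto
  moreover have "Inf ?S < real (2 * h1) + 1"
    using h1 by (simp add: successive_l1_minimum_def)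
  ultimately have "\<exists>r\<in>?S. r < real (2 * h1) + 1"
    by (intro cInf_lessD) auto
  then obtain r where "r \<in> ?S" and r: "r < real (2 * h1) + 1"
    by (elim bexE)
  then obtain c where c: "c \<in> ?L" "l1_norm c \<le> r" "c \<noteq> 0"
    by (auto simp: card_1_singleton_iff)
  obtain m :: nat where m: "l1_norm c = real (2 * m)"
    using l1_norm_coefficient_lattice[OF c(1)] by blast
  have "real (2 * h1) \<le> l1_norm c"
    using first_l1_minimum_le[OF c(1,3)] h1 by simp
  then have "m = h1" using m c(2) r by simp
  with c m that show ?thesis by blast
qed

text \<open>If \<open>v\<close> were off the line through \<open>c\<close>, the two would be
  independent and both shorter than the second minimum. On the line, removing the integer part of
  the factor leaves a lattice vector shorter than \<open>c\<close>, which must vanish.\<close>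

lemma multiple_of_shortest_vector:
  assumes c: "c \<in> coefficient_lattice a" "c \<noteq> 0"
    and min: "l1_norm c = successive_l1_minimum 1 (coefficient_lattice a)"
    and v: "v \<in> coefficient_lattice a"
    and less: "l1_norm v < successive_l1_minimum 2 (coefficient_lattice a)"
      "l1_norm c < successive_l1_minimum 2 (coefficient_lattice a)"
  shows "\<exists>m::int. v = of_int m *\<^sub>R c"
proof -
  let ?L = "coefficient_lattice a"
  have "v \<in> span {c}"
  proof (rule ccontr)
    assume ns: "v \<notin> span {c}"
    then have "v \<noteq> c" by (auto intro: span_base)
    have "independent {v, c}"
      using ns c(2) by (simp add: independent_insert)
    then have "successive_l1_minimum 2 ?L \<le> max (l1_norm v) (l1_norm c)"
      using c v \<open>v \<noteq> c\<close> by (intro successive_l1_minimum_le[of "{v, c}"]) auto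
    with less show False by simp
  qed
  then obtain q where q: "v = q *\<^sub>R c" by (auto simp: span_singleton)
  define w where "w = v - of_int \<lfloor>q\<rfloor> *\<^sub>R c"
  have wL: "w \<in> ?L" unfolding w_def by (rule coefficient_lattice_diff_scaleR[OF c(1) v])
  have w: "w = frac q *\<^sub>R c" by (simp add: w_def q frac_def algebra_simps)
  have "w = 0"
  proof (rule ccontr)
    assume "w \<noteq> 0"
    then have le: "l1_norm c \<le> frac q * l1_norm c"
      using first_l1_minimum_le[OF wL] min by (simp add: w l1_norm_scaleR)
    obtain i where "c $ i \<noteq> 0" using c(2) by (auto simp: vec_eq_iff)
    then have "l1_norm c > 0"
      unfolding l1_norm_def by (intro sum_pos2[of _ i]) auto
    with le frac_lt_1[of q] show False by simp
  qed
  then show ?thesis by (auto simp: w_def)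
qed

section \<open>Differences of vectors with equal value\<close>

lemma weight_eq_iff:
  assumes "x \<in> compositions h" "y \<in> compositions h"
  shows "weight a x = weight a y \<longleftrightarrow>
    of_int_vec (\<lambda>i. int (x i) - int (y i)) \<in> coefficient_lattice a"
proof -
  have "(\<Sum>i\<in>UNIV. int (x i) - int (y i)) = 0"
    using assms by (simp add: compositions_def sum_subtractf flip: of_nat_sum)
  then show ?thesis
    by (simp add: of_int_vec_in_coefficient_lattice_iff weight_def left_diff_distrib sum_subtractf)
qed

lemma l1_norm_diff_compositions_le:
  assumes "x \<in> compositions h" "y \<in> compositions h"
  shows "l1_norm (of_int_vec (\<lambda>i. int (x i) - int (y i))) \<le> real (2 * h)"
proof -
  have "(\<Sum>i\<in>UNIV. \<bar>int (x i) - int (y i)\<bar>) \<le> (\<Sum>i\<in>UNIV. int (x i) + int (y i))"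
    by (rule sum_mono) auto
  also have "\<dots> = int (2 * h)"
    using assms by (simp add: compositions_def sum.distrib flip: of_nat_sum)
  finally show ?thesis
    unfolding l1_norm_of_int_vec by linarith
qed

section \<open>Counting classes modulo multiples of a fixed vector\<close>

lemma card_compositions_above:
  fixes p :: "'n::finite \<Rightarrow> nat"
  assumes "sum p UNIV \<le> h"
  shows "card {x \<in> compositions h. \<forall>i. p i \<le> x i}
    = (h - sum p UNIV + CARD('n) - 1) choose (CARD('n) - 1)"
proof -
  have "bij_betw (\<lambda>y i. y i + p i) (compositions (h - sum p UNIV))
      {x \<in> compositions h. \<forall>i. p i \<le> x i}"
  proof (rule bij_betwI[where g = "\<lambda>x i. x i - p i"])
    show "(\<lambda>y i. y i + p i) \<in> compositions (h - sum p UNIV) \<rightarrow>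
        {x \<in> compositions h. \<forall>i. p i \<le> x i}"
      using assms by (auto simp: compositions_def sum.distrib)
    show "(\<lambda>x i. x i - p i) \<in> {x \<in> compositions h. \<forall>i. p i \<le> x i} \<rightarrow>
        compositions (h - sum p UNIV)"
      by (auto simp: compositions_def sum_subtractf_nat)
  qed (auto simp: compositions_def)
  then show ?thesis
    by (simp add: bij_betw_same_card[symmetric] card_compositions)
qed

text \<open>Combinatorial core, free of the lattice: the fibres of \<open>f\<close> are the traces
  of the progressions with difference \<open>d\<close>, and each has exactly one member from which
  \<open>d\<close> cannot be subtracted within the natural numbers.\<close>

lemma card_image_compositions_mod:
  fixes f :: "('n::finite \<Rightarrow> nat) \<Rightarrow> 'b" and d :: "'n \<Rightarrow> int"
  assumes d0: "sum d UNIV = 0" and norm: "(\<Sum>i\<in>UNIV. \<bar>d i\<bar>) = 2 * int s" and "s > 0" "s \<le> h"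
    and f: "\<And>x y. \<lbrakk>x \<in> compositions h; y \<in> compositions h\<rbrakk> \<Longrightarrow>
      f x = f y \<longleftrightarrow> (\<exists>m. \<forall>i. int (x i) - int (y i) = m * d i)"
  shows "int (card (f ` compositions h)) = int ((h + CARD('n) - 1) choose (CARD('n) - 1))
    - int ((h - s + CARD('n) - 1) choose (CARD('n) - 1))"
proof -
  let ?X = "compositions h :: ('n \<Rightarrow> nat) set"
  \<comment> \<open>\<open>p\<close> is the positive part of \<open>d\<close>, so \<open>U\<close>
    consists of the vectors \<open>x\<close> for which \<open>x - d\<close> has no negative
    coordinate.\<close>
  define p where "p i = nat (d i)" for i
  define U where "U = {x \<in> ?X. \<forall>i. p i \<le> x i}"
  have UX: "U \<subseteq> ?X" by (auto simp: U_def)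
  \<comment> \<open>As the coordinates of \<open>d\<close> sum to zero, its positive part carries
    half of the norm.\<close>
  have "2 * (\<Sum>i\<in>UNIV. int (p i)) = (\<Sum>i\<in>UNIV. \<bar>d i\<bar> + d i)"
    unfolding sum_distrib_left by (rule sum.cong) (auto simp: p_def)
  then have "int (sum p UNIV) = int s" using d0 norm by (simp add: sum.distrib)
  then have p: "sum p UNIV = s" by linarith
  \<comment> \<open>Subtracting \<open>d\<close> strictly lowers this coordinate, which makes it a
    measure for the descent below.\<close>
  then obtain j where j: "d j > 0"
    using \<open>s > 0\<close> unfolding p_def
    by (metis less_irrefl nat_le_0 not_less sum.neutral)
  \<comment> \<open>Here \<open>y = x + m * d\<close>. Where \<open>y i < p i = d i\<close>, this
    would make \<open>x i\<close> negative.\<close>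
  have neg: False if x: "x \<in> ?X" and y: "y \<in> ?X" "y \<notin> U" and m: "m > 0"
    and xy: "\<And>i. int (y i) - int (x i) = m * d i" for x y m
  proof -
    obtain i where i: "y i < p i" using y by (auto simp: U_def not_le)
    then have d: "d i > 0" "int (y i) < d i" by (auto simp: p_def)
    then have "d i \<le> m * d i" using m by simp
    then show False using xy[of i] d by linarith
  qed
  have inj: "inj_on f (?X - U)"
  proof (rule inj_onI)
    fix x y assume x: "x \<in> ?X - U" and y: "y \<in> ?X - U" and "f x = f y"
    then obtain m where m: "\<And>i. int (x i) - int (y i) = m * d i" using f by blast
    have "\<not> m > 0" using neg[of y x m] x y m by auto
    moreover have "\<not> - m > 0"
    proof
      assume "- m > 0"
      moreover have "int (y i) - int (x i) = - m * d i" for i using m[of i] by simp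
      ultimately show False using neg[of x y "- m"] x y by auto
    qed
    ultimately have "m = 0" by simp
    then show "x = y" using m by auto
  qed
  have "f ` ?X \<subseteq> f ` (?X - U)"
  proof
    fix z assume "z \<in> f ` ?X"
    then obtain x where "x \<in> ?X \<and> f x = z" by blast
    \<comment> \<open>Among the vectors of value \<open>z\<close>, one with least
      \<open>j\<close>-th coordinate lies outside \<open>U\<close>: otherwise subtracting
      \<open>d\<close> would give a smaller one.\<close>
    from ex_has_least_nat[where P = "\<lambda>x. x \<in> ?X \<and> f x = z" and m = "\<lambda>x. x j", OF this]
    obtain y where y: "y \<in> ?X" "f y = z"
      and least: "\<And>x. x \<in> ?X \<Longrightarrow> f x = z \<Longrightarrow> y j \<le> x j" by blast
    have "y \<notin> U"
    proof
      assume "y \<in> U"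
      then have ge: "d i \<le> int (y i)" for i by (auto simp: U_def p_def nat_le_iff)
      define w where "w i = nat (int (y i) - d i)" for i
      have w: "int (w i) = int (y i) - d i" for i using ge[of i] by (simp add: w_def)
      have "int (sum w UNIV) = int (sum y UNIV)" by (simp add: w sum_subtractf d0)
      then have wX: "w \<in> ?X" using y(1) by (simp only: compositions_def of_nat_eq_iff mem_Collect_eq)
      have "f w = f y"
        unfolding f[OF wX y(1)] by (intro exI[of _ "-1"]) (simp add: w)
      then have "y j \<le> w j" using least[OF wX] y by simp
      then show False using w[of j] j by linarith
    qed
    with y show "z \<in> f ` (?X - U)" by blast
  qed
  then have "f ` ?X = f ` (?X - U)" by blast
  then have "card (f ` ?X) = card (?X - U)" by (simp add: card_image[OF inj])
  also have "int \<dots> = int (card ?X) - int (card U)"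
    using card_mono[OF finite_compositions UX]
    by (simp add: card_Diff_subset[OF finite_subset[OF UX finite_compositions] UX])
  also have "card U = (h - s + CARD('n) - 1) choose (CARD('n) - 1)"
    unfolding U_def using card_compositions_above[of p h] \<open>s \<le> h\<close> p by simp
  finally show ?thesis by (simp add: card_compositions)
qed

section \<open>The two ranges of \<open>h\<close>\<close>

lemma card_sumset_less_first_minimum:
  fixes a :: "int ^ 'n"
  assumes h1: "successive_l1_minimum 1 (coefficient_lattice a) = real (2 * h1)" and less: "h < h1"
  shows "card (sumset h (range (\<lambda>i. a $ i))) = (h + CARD('n) - 1) choose (CARD('n) - 1)"
proof -
  let ?L = "coefficient_lattice a"
  have "inj_on (weight a) (compositions h)"
  proof (rule inj_onI)
    fix x y :: "'n \<Rightarrow> nat"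
    assume xy: "x \<in> compositions h" "y \<in> compositions h" "weight a x = weight a y"
    define v where "v = of_int_vec (\<lambda>i. int (x i) - int (y i))"
    have "v \<in> ?L" using xy weight_eq_iff unfolding v_def by blast
    moreover have "l1_norm v < real (2 * h1)"
      using l1_norm_diff_compositions_le[OF xy(1,2)] less unfolding v_def by simp
    ultimately have "v = 0" using first_l1_minimum_le[of v ?L] h1 by linarith
    then show "x = y" by (auto simp: v_def of_int_vec_def vec_eq_iff)
  qed
  then show ?thesis
    by (simp add: sumset_eq_weight card_image card_compositions)
qed

text \<open>Applies the counting modulo \<open>d\<close> to the integer coordinates \<open>d\<close>
  of a shortest lattice vector. The equation is stated in the integers to avoid truncated
  subtraction.\<close>

lemma card_sumset_less_second_minimum:
  fixes a :: "int ^ 'n"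
  assumes inj: "inj (\<lambda>i. a $ i)" and card: "CARD('n) \<ge> 4"
    and h1: "successive_l1_minimum 1 (coefficient_lattice a) = real (2 * h1)"
    and h2: "successive_l1_minimum 2 (coefficient_lattice a) = real (2 * h2)"
    and h: "h1 \<le> h" "h < h2"
  shows "int (card (sumset h (range (\<lambda>i. a $ i))))
    = int ((h + CARD('n) - 1) choose (CARD('n) - 1))
      - int ((h - h1 + CARD('n) - 1) choose (CARD('n) - 1))"
proof -
  let ?L = "coefficient_lattice a"
  obtain c where c: "c \<in> ?L" "c \<noteq> 0" "l1_norm c = real (2 * h1)"
    using first_l1_minimum_attained[OF inj card h1] by blast
  obtain d where d: "c = of_int_vec d" using c(1) by (rule coefficient_lattice_of_int_vecE)
  have d0: "sum d UNIV = 0"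
    using c(1) by (simp add: d of_int_vec_in_coefficient_lattice_iff)
  have "real_of_int (\<Sum>i\<in>UNIV. \<bar>d i\<bar>) = of_int (2 * int h1)"
    using c(3) by (simp add: d l1_norm_of_int_vec)
  then have norm: "(\<Sum>i\<in>UNIV. \<bar>d i\<bar>) = 2 * int h1" by (simp only: of_int_eq_iff)
  \<comment> \<open>This is what gives \<open>d\<close> a positive coordinate in the counting
    lemma.\<close>
  have "h1 > 0"
  proof (rule ccontr)
    assume "\<not> h1 > 0"
    then have "\<forall>i. d i = 0" using norm by (simp add: sum_nonneg_eq_0_iff)
    then show False using c(2) by (simp add: d of_int_vec_def vec_eq_iff)
  qed
  have "weight a x = weight a y \<longleftrightarrow> (\<exists>m. \<forall>i. int (x i) - int (y i) = m * d i)"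
    if xy: "x \<in> compositions h" "y \<in> compositions h" for x y
  proof
    assume eq: "weight a x = weight a y"
    define v where "v = of_int_vec (\<lambda>i. int (x i) - int (y i))"
    have vL: "v \<in> ?L" using xy eq weight_eq_iff unfolding v_def by blast
    \<comment> \<open>Both norms are at most \<open>2 * h\<close>: that of \<open>v\<close> as a
      difference of compositions of \<open>h\<close>, that of \<open>c\<close> because
      \<open>h1 \<le> h\<close>.\<close>
    have "l1_norm v < real (2 * h2)" "l1_norm c < real (2 * h2)"
      using l1_norm_diff_compositions_le[OF xy] h c(3) unfolding v_def by simp_all
    then obtain m :: int where m: "v = of_int m *\<^sub>R c"
      using multiple_of_shortest_vector[OF c(1,2) _ vL] c(3) h1 h2 by auto
    have "real_of_int (int (x i) - int (y i)) = of_int (m * d i)" for i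
      using arg_cong[OF m, of "\<lambda>u. u $ i"] by (simp add: v_def d of_int_vec_def)
    then show "\<exists>m. \<forall>i. int (x i) - int (y i) = m * d i" by (metis of_int_eq_iff)
  next
    assume "\<exists>m. \<forall>i. int (x i) - int (y i) = m * d i"
    then obtain m where m: "\<And>i. int (x i) - int (y i) = m * d i" by blast
    have "of_int_vec (\<lambda>i. m * d i) \<in> ?L"
      using c(1) by (simp add: d of_int_vec_in_coefficient_lattice_iff mult.assoc
          flip: sum_distrib_left)
    then show "weight a x = weight a y" by (simp add: weight_eq_iff[OF xy] m)
  qed
  then show ?thesis
    unfolding sumset_eq_weight
    by (rule card_image_compositions_mod[OF d0 norm \<open>h1 > 0\<close> h(1)])
qed

theorem theorem1:
  fixes a :: "int ^ 'n" and A :: "int set" and k h h1 h2 :: nat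
  assumes "k = CARD('n)" and "k \<ge> 4"
    and "inj (\<lambda>i. a $ i)" and "A = range (\<lambda>i. a $ i)"
    and "successive_l1_minimum 1 (coefficient_lattice a) = real (2 * h1)"
    and "successive_l1_minimum 2 (coefficient_lattice a) = real (2 * h2)"
  shows "(1 \<le> h \<and> h < h1 \<longrightarrow>
            card (sumset h A) = (h + k - 1) choose (k - 1)) \<and>
         (h1 \<le> h \<and> h < h2 \<longrightarrow>
            int (card (sumset h A)) =
              int ((h + k - 1) choose (k - 1)) - int ((h - h1 + k - 1) choose (k - 1)))"
  unfolding assms(1,4)
  using card_sumset_less_first_minimum[OF assms(5)]
    card_sumset_less_second_minimum[OF assms(3) _ assms(5,6)] assms(1,2)
  by blast

end
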